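(* The Wajsberg hoops $\mathbf C_\omega$, $\mathbf C^\omega_n$ for $n\ge1$, and $\mathbf W_n$ for $n\ge2$ are not projective in the variety $\mathsf{WH}$ of Wajsberg hoops, nor in any variety of residuated lattices that contains $\mathsf{WH}$.
   Context: A Wajsberg hoop is an algebra $(A,\cdot,\to,1)$ with $(A,\cdot,1)$ a commutative monoid satisfying $x\to x=1$, $x\cdot(x\to y)=y\cdot(y\to x)$, $(x\cdot y)\to z=x\to(y\to z)$, and $(x\to y)\to y=(y\to x)\to x$; it is lattice-ordered by $x\le y$ iff $x\to y=1$, with $x\wedge y=x\cdot(x\to y)$, $x\vee y=(x\to y)\to y$. Wajsberg hoops are regarded as (commutative, integral) residuated lattices in the signature $\{\cdot,\to,\wedge,\vee,1\}$. A residuated lattice is a lattice-ordered monoid whose multiplication is residuated on both sides; in the commutative case there is a single residual $\to$ with $x\cdot y\le z$ iff $y\le x\to z$. An algebra $\mathbf P$ in a variety $\mathsf V$ is projective in $\mathsf V$ if for all $\mathbf A,\mathbf B\in\mathsf V$, every homomorphism $f:\mathbf P\to\mathbf A$ and every surjective homomorphism $g:\mathbf B\to\mathbf A$, there is a homomorphism $h:\mathbf P\to\mathbf B$ with $f=g\circ h$. $\mathbf W_n$ is the $n$-element totally ordered bounded Wajsberg hoop: for $n\ge2$, the subalgebra $\{0,\frac1{n-1},\dots,\frac{n-2}{n-1},1\}$ of $[0,1]$ with operations $x\cdot y=\max\{0,x+y-1\}$, $x\to y=\min\{1,1-x+y\}$. $\mathbf C_\omega$ has universe $\{a^0=1,a^1,a^2,\dots\}$,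 ordered by $1=a^0>a^1>a^2>\cdots$, with $a^m\cdot a^n=a^{m+n}$ and $a^m\to a^n=a^{\max(n-m,0)}$. $\mathbf C^\omega_n$ is the reduct, omitting the constant $0$, of the MV-algebra $\Gamma(\mathbf Z\times_{\mathrm{lex}}\mathbf Z,(n,0))$, where $\mathbf Z\times_{\mathrm{lex}}\mathbf Z$ is $\mathbb Z\times\mathbb Z$ with componentwise addition and lexicographic order. For an abelian lattice-ordered group $G$ with strong unit $u$, $\Gamma(G,u)$ is the interval $[0,u]$ with $a\oplus b=(a+b)\wedge u$ and $\neg a=u-a$, so that $a\cdot b=\neg(\neg a\oplus\neg b)$ and $a\to b=\neg a\oplus b$, and the constant $1$ is $u$. *)

theory Defs
  imports
    Complex_Main
    "HOL-Algebra.Group"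
    "HOL-Library.Product_Plus"
    "HOL-Library.Product_Lexorder"
    "HOL-Library.Lattice_Algebras"
begin

section \<open>Wajsberg hoops\<close>

record 'a hoop = "'a monoid" +
  imp :: "'a \<Rightarrow> 'a \<Rightarrow> 'a" (infixr "\<leadsto>\<index>" 65)

locale wajsberg_hoop = comm_monoid A for A (structure) +
  assumes imp_closed: "\<lbrakk>x \<in> carrier A; y \<in> carrier A\<rbrakk> \<Longrightarrow> x \<leadsto> y \<in> carrier A"
    and imp_self: "x \<in> carrier A \<Longrightarrow> x \<leadsto> x = \<one>"
    and divisibility: "\<lbrakk>x \<in> carrier A; y \<in> carrier A\<rbrakk> \<Longrightarrow> x \<otimes> (x \<leadsto> y) = y \<otimes> (y \<leadsto> x)"
    and currying: "\<lbrakk>x \<in> carrier A; y \<in> carrier A; z \<in> carrier A\<rbrakk>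
      \<Longrightarrow> (x \<otimes> y) \<leadsto> z = x \<leadsto> (y \<leadsto> z)"
    and tanaka: "\<lbrakk>x \<in> carrier A; y \<in> carrier A\<rbrakk> \<Longrightarrow> (x \<leadsto> y) \<leadsto> y = (y \<leadsto> x) \<leadsto> x"


section \<open>Residuated lattices\<close>

text \<open>\<open>ldiv R x z\<close> is the residual usually written \<open>x\z\<close>, and
  \<open>rdiv R z y\<close> is the one written \<open>z/y\<close>.\<close>

record 'a reslat = "'a monoid" +
  ldiv :: "'a \<Rightarrow> 'a \<Rightarrow> 'a"
  rdiv :: "'a \<Rightarrow> 'a \<Rightarrow> 'a"
  rmeet :: "'a \<Rightarrow> 'a \<Rightarrow> 'a"
  rjoin :: "'a \<Rightarrow> 'a \<Rightarrow> 'a"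

definition rle :: "('a, 'm) reslat_scheme \<Rightarrow> 'a \<Rightarrow> 'a \<Rightarrow> bool" where
  "rle R x y \<longleftrightarrow> rmeet R x y = x"

text \<open>Compatibility of multiplication with the order is a consequence of the residuation laws.\<close>

locale residuated_lattice = monoid R for R (structure) +
  assumes ldiv_closed: "\<lbrakk>x \<in> carrier R; y \<in> carrier R\<rbrakk> \<Longrightarrow> ldiv R x y \<in> carrier R"
    and rdiv_closed: "\<lbrakk>x \<in> carrier R; y \<in> carrier R\<rbrakk> \<Longrightarrow> rdiv R x y \<in> carrier R"
    and rmeet_closed: "\<lbrakk>x \<in> carrier R; y \<in> carrier R\<rbrakk> \<Longrightarrow> rmeet R x y \<in> carrier R"
    and rjoin_closed: "\<lbrakk>x \<in> carrier R; y \<in> carrier R\<rbrakk> \<Longrightarrow> rjoin R x y \<in> carrier R"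
    and rmeet_comm: "\<lbrakk>x \<in> carrier R; y \<in> carrier R\<rbrakk> \<Longrightarrow> rmeet R x y = rmeet R y x"
    and rjoin_comm: "\<lbrakk>x \<in> carrier R; y \<in> carrier R\<rbrakk> \<Longrightarrow> rjoin R x y = rjoin R y x"
    and rmeet_assoc: "\<lbrakk>x \<in> carrier R; y \<in> carrier R; z \<in> carrier R\<rbrakk>
      \<Longrightarrow> rmeet R (rmeet R x y) z = rmeet R x (rmeet R y z)"
    and rjoin_assoc: "\<lbrakk>x \<in> carrier R; y \<in> carrier R; z \<in> carrier R\<rbrakk>
      \<Longrightarrow> rjoin R (rjoin R x y) z = rjoin R x (rjoin R y z)"
    and rmeet_rjoin_absorb: "\<lbrakk>x \<in> carrier R; y \<in> carrier R\<rbrakk> \<Longrightarrow> rmeet R x (rjoin R x y) = x"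
    and rjoin_rmeet_absorb: "\<lbrakk>x \<in> carrier R; y \<in> carrier R\<rbrakk> \<Longrightarrow> rjoin R x (rmeet R x y) = x"
    and ldiv_residual: "\<lbrakk>x \<in> carrier R; y \<in> carrier R; z \<in> carrier R\<rbrakk>
      \<Longrightarrow> rle R (x \<otimes> y) z \<longleftrightarrow> rle R y (ldiv R x z)"
    and rdiv_residual: "\<lbrakk>x \<in> carrier R; y \<in> carrier R; z \<in> carrier R\<rbrakk>
      \<Longrightarrow> rle R (x \<otimes> y) z \<longleftrightarrow> rle R x (rdiv R z y)"


section \<open>Wajsberg hoops as residuated lattices\<close>

definition reslat_of_hoop :: "'a hoop \<Rightarrow> 'a reslat" where
  "reslat_of_hoop A =
    \<lparr>carrier = carrier A, mult = mult A, one = one A,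
     ldiv = imp A,
     rdiv = (\<lambda>y x. imp A x y),
     rmeet = (\<lambda>x y. mult A x (imp A x y)),
     rjoin = (\<lambda>x y. imp A (imp A x y) y)\<rparr>"

definition hoop_reduct :: "'a reslat \<Rightarrow> 'a hoop" where
  "hoop_reduct R = \<lparr>carrier = carrier R, mult = mult R, one = one R, imp = ldiv R\<rparr>"

text \<open>Operations are total functions whose values outside the carrier are irrelevant, so
  agreement with \<open>reslat_of_hoop\<close> is demanded on the carrier only.\<close>

definition WH :: "'a reslat set" where
  "WH = {R. wajsberg_hoop (hoop_reduct R) \<and>
    (\<forall>x\<in>carrier R. \<forall>y\<in>carrier R.
      rdiv R y x = ldiv R x y \<and>
      rmeet R x y = x \<otimes>\<^bsub>R\<^esub> ldiv R x y \<and>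
      rjoin R x y = ldiv R (ldiv R x y) y)}"

lemma reslat_of_hoop_in_WH: "wajsberg_hoop A \<Longrightarrow> reslat_of_hoop A \<in> WH"
  by (cases A) (simp add: WH_def reslat_of_hoop_def hoop_reduct_def)


section \<open>Varieties of residuated lattices\<close>

datatype rl_term =
    Var nat
  | One
  | Mult rl_term rl_term
  | LDiv rl_term rl_term
  | RDiv rl_term rl_term
  | Meet rl_term rl_term
  | Join rl_term rl_term

primrec eval_term :: "'a reslat \<Rightarrow> (nat \<Rightarrow> 'a) \<Rightarrow> rl_term \<Rightarrow> 'a" where
  "eval_term R v (Var i) = v i"
| "eval_term R v One = \<one>\<^bsub>R\<^esub>"
| "eval_term R v (Mult s t) = eval_term R v s \<otimes>\<^bsub>R\<^esub> eval_term R v t"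
| "eval_term R v (LDiv s t) = ldiv R (eval_term R v s) (eval_term R v t)"
| "eval_term R v (RDiv s t) = rdiv R (eval_term R v s) (eval_term R v t)"
| "eval_term R v (Meet s t) = rmeet R (eval_term R v s) (eval_term R v t)"
| "eval_term R v (Join s t) = rjoin R (eval_term R v s) (eval_term R v t)"

definition satisfies_eq :: "'a reslat \<Rightarrow> rl_term \<times> rl_term \<Rightarrow> bool" where
  "satisfies_eq R e \<longleftrightarrow>
    (\<forall>v. range v \<subseteq> carrier R \<longrightarrow> eval_term R v (fst e) = eval_term R v (snd e))"

text \<open>The members, with universe contained in \<open>'a\<close>, of an equationally defined class of
  residuated lattices.\<close>

definition rl_variety :: "'a reslat set \<Rightarrow> bool" where
  "rl_variety V \<longleftrightarrow>
    (\<exists>E. V = {R. residuated_lattice R \<and> (\<forall>e\<in>E. satisfies_eq R e)})"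


section \<open>Projectivity\<close>

definition rl_hom :: "'a reslat \<Rightarrow> 'b reslat \<Rightarrow> ('a \<Rightarrow> 'b) set" where
  "rl_hom R S = {h. h \<in> carrier R \<rightarrow> carrier S \<and> h \<one>\<^bsub>R\<^esub> = \<one>\<^bsub>S\<^esub> \<and>
    (\<forall>x\<in>carrier R. \<forall>y\<in>carrier R.
      h (x \<otimes>\<^bsub>R\<^esub> y) = h x \<otimes>\<^bsub>S\<^esub> h y \<and>
      h (ldiv R x y) = ldiv S (h x) (h y) \<and>
      h (rdiv R x y) = rdiv S (h x) (h y) \<and>
      h (rmeet R x y) = rmeet S (h x) (h y) \<and>
      h (rjoin R x y) = rjoin S (h x) (h y))}"

text \<open>The universe type \<open>'p\<close> of the tested algebra need not be the type \<open>'u\<close> over which the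
  members of \<open>V\<close> range. Membership of \<open>P\<close> in the variety is a presupposition of the notion and
  not part of the predicate, so that a negated \<open>projective_in\<close> always refers to the lifting
  property itself.\<close>

definition projective_in :: "'u reslat set \<Rightarrow> 'p reslat \<Rightarrow> bool" where
  "projective_in V P \<longleftrightarrow>
    (\<forall>A\<in>V. \<forall>B\<in>V. \<forall>f\<in>rl_hom P A. \<forall>g\<in>rl_hom B A. g ` carrier B = carrier A \<longrightarrow>
      (\<exists>h\<in>rl_hom P B. \<forall>x\<in>carrier P. f x = g (h x)))"


section \<open>The algebras\<close>

definition W :: "nat \<Rightarrow> real hoop" where
  "W n =
    \<lparr>carrier = (\<lambda>k. real k / real (n - 1)) ` {0..n - 1},
     mult = (\<lambda>x y. max 0 (x + y - 1)),
     one = 1,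
     imp = (\<lambda>x y. min 1 (1 - x + y))\<rparr>"

text \<open>The element \<open>a\<^sup>k\<close> is represented by its exponent \<open>k\<close>; subtraction on \<^typ>\<open>nat\<close> is
  truncated.\<close>

definition C_omega :: "nat hoop" where
  "C_omega =
    \<lparr>carrier = UNIV,
     mult = (\<lambda>m n. m + n),
     one = 0,
     imp = (\<lambda>m n. n - m)\<rparr>"

text \<open>The componentwise sum and the lexicographic order on pairs are those of the library.\<close>

instance prod :: (linordered_ab_group_add, linordered_ab_group_add) lattice_ab_group_add
  by standard (auto simp: less_eq_prod_def)

definition mv_oplus :: "'g::lattice_ab_group_add \<Rightarrow> 'g \<Rightarrow> 'g \<Rightarrow> 'g" where
  "mv_oplus u a b = inf (a + b) u"

definition mv_neg :: "'g::lattice_ab_group_add \<Rightarrow> 'g \<Rightarrow> 'g" where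
  "mv_neg u a = u - a"

text \<open>The reduct, without the constant \<open>0\<close>, of the MV-algebra \<open>\<Gamma>(G,u)\<close>.\<close>

definition Gamma_hoop :: "'g::lattice_ab_group_add \<Rightarrow> 'g hoop" where
  "Gamma_hoop u =
    \<lparr>carrier = {0..u},
     mult = (\<lambda>a b. mv_neg u (mv_oplus u (mv_neg u a) (mv_neg u b))),
     one = u,
     imp = (\<lambda>a b. mv_oplus u (mv_neg u a) b)\<rparr>"

definition C_lex :: "nat \<Rightarrow> (int \<times> int) hoop" where
  "C_lex n = Gamma_hoop (int n, 0)"

text \<open>These algebras are Wajsberg hoops; so the associated residuated lattices lie in \<open>WH\<close> by
  \<open>reslat_of_hoop_in_WH\<close>.\<close>

lemma wajsberg_hoop_C_omega: "wajsberg_hoop C_omega"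
  by unfold_locales (auto simp: C_omega_def Units_def)

lemma wajsberg_hoop_Gamma_hoop:
  fixes u :: "'g::lattice_ab_group_add"
  assumes u: "0 \<le> u"
  shows "wajsberg_hoop (Gamma_hoop u)"
proof -
  have m: "mv_neg u (mv_oplus u (mv_neg u a) (mv_neg u b)) = sup (a + b - u) 0" for a b
    by (simp add: mv_neg_def mv_oplus_def diff_inf_eq_sup add_sup_distrib_left algebra_simps)
  have i: "mv_oplus u (mv_neg u a) b = inf (u - a + b) u" for a b
    by (simp add: mv_neg_def mv_oplus_def)
  have mi: "sup (a + inf (u - a + b) u - u) 0 = inf a b" if "0 \<le> a" "0 \<le> b" for a b
  proof -
    have "a + inf (u - a + b) u - u = (a - u) + inf (u - a + b) u" by (simp add: algebra_simps)
    also have "\<dots> = inf b a" by (simp only: add_inf_distrib_left) (simp add: algebra_simps)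
    finally show ?thesis using that by (simp add: sup.absorb1 inf_commute)
  qed
  have ii: "inf (u - inf (u - a + b) u + b) u = sup a b" if "a \<le> u" "b \<le> u" for a b
  proof -
    have "u - inf (u - a + b) u + b = (u + b) - inf (u - a + b) u" by (simp add: algebra_simps)
    also have "\<dots> = sup a b"
      by (simp only: diff_inf_eq_sup add_sup_distrib_left) (simp add: algebra_simps)
    finally show ?thesis using that by (simp add: inf.absorb1)
  qed
  have cu: "inf (u - sup (a + b - u) 0 + c) u = inf (u - a + inf (u - b + c) u) u"
    if "a \<le> u" "0 \<le> c" for a b c
  proof -
    have "u - sup (a + b - u) 0 + c = (u + c) - sup (a + b - u) 0" by (simp add: algebra_simps)
    also have "\<dots> = inf (u + u - a - b + c) (u + c)"
      by (simp only: diff_sup_eq_inf add_inf_distrib_left) (simp add: algebra_simps)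
    finally have 1: "inf (u - sup (a + b - u) 0 + c) u = inf (u + u - a - b + c) u"
      using that by (simp add: inf_assoc inf.absorb2)
    have "u - a + inf (u - b + c) u = inf (u + u - a - b + c) (u + u - a)"
      by (simp only: add_inf_distrib_left) (simp add: algebra_simps)
    moreover have "u \<le> u + u - a" using that by (simp add: algebra_simps)
    ultimately have "inf (u - a + inf (u - b + c) u) u = inf (u + u - a - b + c) u"
      by (simp add: inf_assoc inf.absorb2)
    with 1 show ?thesis by simp
  qed
  have as: "sup (sup (a + b - u) 0 + c - u) 0 = sup (a + b + c - u - u) 0" if "c \<le> u" for a b c
  proof -
    have "sup (a + b - u) 0 + c - u = (c - u) + sup (a + b - u) 0" by (simp add: algebra_simps)
    also have "\<dots> = sup (a + b + c - u - u) (c - u)"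
      by (simp only: add_sup_distrib_left) (simp add: algebra_simps)
    finally show ?thesis using that by (simp add: sup_assoc sup.absorb2)
  qed
  have le: "a + b - u \<le> u" if "a \<le> u" "b \<le> u" for a b
    using add_mono[OF that] by (simp add: algebra_simps)
  have ge: "0 \<le> u - a + b" if "a \<le> u" "0 \<le> b" for a b
    using add_nonneg_nonneg[of "u - a" b] that by simp
  have G: "Gamma_hoop u = \<lparr>carrier = {0..u}, mult = (\<lambda>a b. sup (a + b - u) 0), one = u,
      imp = (\<lambda>a b. inf (u - a + b) u)\<rparr>"
    unfolding Gamma_hoop_def m by (simp add: i fun_eq_iff)
  have mc: "sup (a + b - u) 0 = sup (b + a - u) 0" for a b
    by (simp only: add.commute)
  have as': "sup (a + sup (b + c - u) 0 - u) 0 = sup (a + b + c - u - u) 0" if "a \<le> u" for a b c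
    using as[OF that, of b c] by (simp only: add_ac)
  show ?thesis
    unfolding G
  proof (unfold_locales, goal_cases)
    case (6 x y)
    then show ?case using mc[of x y] by simp
  next
    case (9 x y)
    then show ?case using mi[of x y] mi[of y x] by (simp add: inf_commute)
  next
    case (10 x y z)
    then show ?case using cu[of x z y] by simp
  next
    case (11 x y)
    then show ?case using ii[of x y] ii[of y x] by (simp add: sup_commute)
  qed (use u in \<open>simp_all add: as as' le ge sup.absorb1 inf.absorb1\<close>)
qed

lemma wajsberg_hoop_C_lex: "wajsberg_hoop (C_lex n)"
  unfolding C_lex_def by (rule wajsberg_hoop_Gamma_hoop) (simp add: zero_prod_def)

lemma wajsberg_hoop_W: assumes "2 \<le> n" shows "wajsberg_hoop (W n)"
proof -
  define N where "N = n - 1"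
  have N: "N > 0" using assms by (simp add: N_def)
  have c: "carrier (W n) = {x. 0 \<le> x \<and> x \<le> 1 \<and> x * real N \<in> \<int>}"
  proof (rule subset_antisym; rule subsetI)
    fix x assume "x \<in> carrier (W n)"
    then show "x \<in> {x. 0 \<le> x \<and> x \<le> 1 \<and> x * real N \<in> \<int>}"
      using N by (auto simp: W_def simp flip: N_def One_nat_def)
  next
    fix x assume x: "x \<in> {x. 0 \<le> x \<and> x \<le> 1 \<and> x * real N \<in> \<int>}"
    then obtain k where k: "x * real N = of_int k" by (auto elim: Ints_cases)
    have "0 \<le> x * real N" "x * real N \<le> real N" using x N by (auto simp: mult_left_le_one_le)
    then have "k \<ge> 0" "k \<le> int N" using k by auto
    then show "x \<in> carrier (W n)"
      using N k by (auto simp: W_def simp flip: N_def One_nat_def simp: image_iff field_simps intro!: bexI[of _ "nat k"])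
  qed
  show ?thesis
  proof (unfold_locales, unfold c)
  qed (auto simp: W_def max_def min_def algebra_simps intro: Ints_add Ints_diff)
qed

end

theory Submission
  imports Defs "HOL-Library.Countable_Set"
begin

text \<open>Passing to a larger class of algebras makes projectivity harder, so it suffices to find a
  lifting problem inside \<open>WH\<close> that has no solution.

  Both \<open>C_omega\<close> and \<open>C_lex n\<close> contain an element \<open>a \<noteq> 1\<close> with \<open>a\<^sup>m \<leadsto> a\<^sup>m\<^sup>+\<^sup>1 = a\<close> for all \<open>m\<close>.
  They embed into some \<open>C_lex n\<close>, which is a quotient of an algebra of sequences whose entries lie
  in finite chains. In a finite chain only the unit satisfies these equations, so every homomorphism
  into the algebra of sequences sends \<open>a\<close> to the unit and cannot lift the embedding.

  The algebra \<open>W n\<close> is a quotient of the algebra of those continuous functions \<open>\<real> \<rightarrow> [0,1]\<close> that take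
  the value \<open>1\<close> at \<open>1\<close> and a value in \<open>W n\<close> at \<open>0\<close>, by evaluation at \<open>0\<close>. A lift of the
  identity would send the idempotent \<open>0\<close> to a function with values in \<open>{0, 1}\<close> that jumps between
  \<open>0\<close> and \<open>1\<close>, against the intermediate value theorem.\<close>

section \<open>Homomorphisms, subalgebras and copies of Wajsberg hoops\<close>

definition hoop_hom :: "'a hoop \<Rightarrow> 'b hoop \<Rightarrow> ('a \<Rightarrow> 'b) set" where
  "hoop_hom A B = {h. h \<in> carrier A \<rightarrow> carrier B \<and> h \<one>\<^bsub>A\<^esub> = \<one>\<^bsub>B\<^esub> \<and>
    (\<forall>x\<in>carrier A. \<forall>y\<in>carrier A.
      h (x \<otimes>\<^bsub>A\<^esub> y) = h x \<otimes>\<^bsub>B\<^esub> h y \<and> h (imp A x y) = imp B (h x) (h y))}"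

text \<open>The residuals, meet and join of \<open>reslat_of_hoop\<close> are terms in
  multiplication and implication, so maps preserving these two and the unit preserve
  everything.\<close>

lemma rl_hom_reslat_of_hoop:
  assumes "wajsberg_hoop A"
  shows "rl_hom (reslat_of_hoop A) (reslat_of_hoop B) = hoop_hom A B"
proof -
  interpret wajsberg_hoop A by fact
  show ?thesis
    by (auto simp: rl_hom_def hoop_hom_def reslat_of_hoop_def imp_closed)
qed

lemma hoop_hom_compose:
  "f \<in> hoop_hom A B \<Longrightarrow> g \<in> hoop_hom B C \<Longrightarrow> (\<lambda>x. g (f x)) \<in> hoop_hom A C"
  by (auto simp: hoop_hom_def Pi_iff)

lemma hoop_hom_nat_pow:
  assumes "wajsberg_hoop A" "h \<in> hoop_hom A B" "a \<in> carrier A"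
  shows "h (a [^]\<^bsub>A\<^esub> (m::nat)) = h a [^]\<^bsub>B\<^esub> m"
proof -
  interpret wajsberg_hoop A by fact
  show ?thesis using assms(2,3) by (induction m) (auto simp: hoop_hom_def)
qed

lemma wajsberg_hoop_subset:
  assumes "wajsberg_hoop A" "S \<subseteq> carrier A" "\<one>\<^bsub>A\<^esub> \<in> S"
    and "\<And>x y. x \<in> S \<Longrightarrow> y \<in> S \<Longrightarrow> x \<otimes>\<^bsub>A\<^esub> y \<in> S"
    and "\<And>x y. x \<in> S \<Longrightarrow> y \<in> S \<Longrightarrow> imp A x y \<in> S"
  shows "wajsberg_hoop (A\<lparr>carrier := S\<rparr>)"
proof -
  interpret wajsberg_hoop A by fact
  note S = subsetD[OF assms(2)]
  show ?thesis
    by unfold_locales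
      (use assms in \<open>auto simp: S m_assoc imp_self currying
        intro: m_comm divisibility tanaka\<close>)
qed

text \<open>Transport of structure along \<open>e\<close>, meant for \<open>e\<close> injective on
  the carrier.\<close>

definition image_hoop :: "('a \<Rightarrow> 'b) \<Rightarrow> 'a hoop \<Rightarrow> 'b hoop" where
  "image_hoop e A = (let d = inv_into (carrier A) e in
    \<lparr>carrier = e ` carrier A,
     mult = (\<lambda>u v. e (d u \<otimes>\<^bsub>A\<^esub> d v)),
     one = e \<one>\<^bsub>A\<^esub>,
     imp = (\<lambda>u v. e (imp A (d u) (d v)))\<rparr>)"

lemma
  assumes "wajsberg_hoop A" "inj_on e (carrier A)"
  shows wajsberg_hoop_image_hoop: "wajsberg_hoop (image_hoop e A)"
    and image_hoop_hom: "e \<in> hoop_hom A (image_hoop e A)"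
    and inv_into_image_hoop_hom: "inv_into (carrier A) e \<in> hoop_hom (image_hoop e A) A"
proof -
  interpret wajsberg_hoop A by fact
  note i = inv_into_f_f[OF assms(2)]
  show "wajsberg_hoop (image_hoop e A)"
    unfolding image_hoop_def Let_def
    by unfold_locales
      (auto simp: i m_assoc imp_closed imp_self currying
        intro!: arg_cong[of _ _ e] intro: m_comm divisibility tanaka)
  show "e \<in> hoop_hom A (image_hoop e A)" "inv_into (carrier A) e \<in> hoop_hom (image_hoop e A) A"
    by (auto simp: hoop_hom_def image_hoop_def Let_def i imp_closed)
qed

section \<open>Transfer of lifting problems between classes and universe types\<close>

lemma not_projective_in_superset:
  "\<not> projective_in U P \<Longrightarrow> U \<subseteq> V \<Longrightarrow> \<not> projective_in V P"
  unfolding projective_in_def by blast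

instance rl_term :: countable
  by countable_datatype

lemma exists_inj_on_of_countable:
  assumes "countable S" "infinite (UNIV :: 'u set)"
  shows "\<exists>e :: 'a \<Rightarrow> 'u. inj_on e S"
proof -
  obtain j :: "nat \<Rightarrow> 'u" where "inj j"
    using infinite_countable_subset[OF assms(2)] by blast
  then have "inj_on (j \<circ> to_nat_on S) S"
    using assms(1) by (intro comp_inj_on inj_on_to_nat_on) (auto intro: inj_on_subset)
  then show ?thesis by blast
qed

text \<open>Choose a preimage of each element of \<open>A\<close> and take the generated subalgebra:
  it consists of values of terms, and there are only countably many terms.\<close>

lemma countable_subhoop_onto:
  fixes A :: "'a hoop" and B :: "'b hoop"
  assumes A: "wajsberg_hoop A" "countable (carrier A)" and B: "wajsberg_hoop B"
    and g: "carrier A \<subseteq> g ` carrier B"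
  obtains S where "S \<subseteq> carrier B" "countable S" "carrier A \<subseteq> g ` S"
    "wajsberg_hoop (B\<lparr>carrier := S\<rparr>)"
proof -
  interpret A: wajsberg_hoop A by fact
  interpret B: wajsberg_hoop B by fact
  let ?s = "inv_into (carrier B) g"
  define v where "v k = ?s (from_nat_into (carrier A) k)" for k
  define S where "S = range (eval_term (reslat_of_hoop B) v)"
  have v: "v k \<in> carrier B" for k
    unfolding v_def
    by (intro inv_into_into subsetD[OF g] from_nat_into) auto
  have "eval_term (reslat_of_hoop B) v t \<in> carrier B" for t
    by (induction t) (auto simp: v reslat_of_hoop_def B.imp_closed)
  then have S: "S \<subseteq> carrier B" by (auto simp: S_def)
  have "x \<in> g ` S" if x: "x \<in> carrier A" for x
  proof -
    obtain k where "x = from_nat_into (carrier A) k"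
      using from_nat_into_surj[OF A(2) x] by metis
    then have "g (v k) = x"
      using f_inv_into_f[of x g "carrier B"] x g by (auto simp: v_def)
    moreover have "v k \<in> S"
      by (auto simp: S_def intro!: image_eqI[of _ _ "Var k"])
    ultimately show ?thesis by blast
  qed
  moreover have "wajsberg_hoop (B\<lparr>carrier := S\<rparr>)"
  proof (rule wajsberg_hoop_subset[OF B S])
    show "\<one>\<^bsub>B\<^esub> \<in> S"
      by (auto simp: S_def reslat_of_hoop_def intro!: image_eqI[of _ _ One])
  next
    fix x y assume "x \<in> S" "y \<in> S"
    then obtain s t where st: "x = eval_term (reslat_of_hoop B) v s"
      "y = eval_term (reslat_of_hoop B) v t" by (auto simp: S_def)
    show "x \<otimes>\<^bsub>B\<^esub> y \<in> S"
      unfolding S_def by (rule range_eqI[of _ _ "Mult s t"]) (simp add: st reslat_of_hoop_def)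
    show "imp B x y \<in> S"
      unfolding S_def by (rule range_eqI[of _ _ "LDiv s t"]) (simp add: st reslat_of_hoop_def)
  qed
  ultimately show thesis using S by (intro that[of S]) (auto simp: S_def)
qed

text \<open>The carrier of \<open>B\<close> may be of any cardinality: a countable subalgebra of \<open>B\<close> still maps onto
  \<open>A\<close>, and countable algebras can be copied into every infinite type.\<close>

lemma not_projective_in_WH:
  fixes A :: "'a hoop" and B :: "'b hoop" and P :: "'p hoop"
  assumes u: "infinite (UNIV :: 'u set)"
    and P: "wajsberg_hoop P"
    and A: "wajsberg_hoop A" "countable (carrier A)"
    and B: "wajsberg_hoop B"
    and f: "f \<in> hoop_hom P A"
    and g: "g \<in> hoop_hom B A" "carrier A \<subseteq> g ` carrier B"
    and no_lift: "\<And>h. h \<in> hoop_hom P B \<Longrightarrow> (\<And>x. x \<in> carrier P \<Longrightarrow> g (h x) = f x) \<Longrightarrow> False"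
  shows "\<not> projective_in (WH :: 'u reslat set) (reslat_of_hoop P)"
proof
  assume proj: "projective_in (WH :: 'u reslat set) (reslat_of_hoop P)"
  obtain S where S: "S \<subseteq> carrier B" "countable S" "carrier A \<subseteq> g ` S"
    "wajsberg_hoop (B\<lparr>carrier := S\<rparr>)"
    using countable_subhoop_onto[OF A B g(2)] .
  define C where "C = B\<lparr>carrier := S\<rparr>"
  have C: "wajsberg_hoop C" "carrier C = S" using S by (auto simp: C_def)
  have gC: "g \<in> hoop_hom C A" using g(1) S(1) by (auto simp: hoop_hom_def C_def)
  have inc: "(\<lambda>x. x) \<in> hoop_hom C B" using S(1) by (auto simp: hoop_hom_def C_def)
  obtain a :: "'a \<Rightarrow> 'u" where a: "inj_on a (carrier A)"
    using exists_inj_on_of_countable[OF A(2) u] by blast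
  obtain c :: "'b \<Rightarrow> 'u" where c: "inj_on c (carrier C)"
    using exists_inj_on_of_countable[OF S(2) u] C(2) by auto
  let ?A = "image_hoop a A" and ?C = "image_hoop c C" and ?d = "inv_into (carrier C) c"
  let ?f = "\<lambda>x. a (f x)" and ?g = "\<lambda>x. a (g (?d x))"
  have wA: "wajsberg_hoop ?A" and wC: "wajsberg_hoop ?C"
    using wajsberg_hoop_image_hoop A(1) a C(1) c by blast+
  have f': "?f \<in> hoop_hom P ?A"
    using hoop_hom_compose[OF f image_hoop_hom[OF A(1) a]] .
  have d: "?d \<in> hoop_hom ?C C" by (rule inv_into_image_hoop_hom[OF C(1) c])
  have g': "?g \<in> hoop_hom ?C ?A"
    using hoop_hom_compose[OF hoop_hom_compose[OF d gC] image_hoop_hom[OF A(1) a]] .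
  have "g ` S = carrier A" using S(3) gC C(2) by (auto simp: hoop_hom_def)
  then have "?g ` carrier ?C = carrier ?A"
    using c by (simp add: image_hoop_def Let_def image_image C(2) flip: image_image[of a g])
  then have onto: "?g ` carrier (reslat_of_hoop ?C) = carrier (reslat_of_hoop ?A)"
    by (simp only: reslat_of_hoop_def partial_object.simps)
  have "?f \<in> rl_hom (reslat_of_hoop P) (reslat_of_hoop ?A)"
    "?g \<in> rl_hom (reslat_of_hoop ?C) (reslat_of_hoop ?A)"
    using f' g' by (simp_all only: rl_hom_reslat_of_hoop[OF P] rl_hom_reslat_of_hoop[OF wC])
  from proj[unfolded projective_in_def, rule_format, OF reslat_of_hoop_in_WH[OF wA]
      reslat_of_hoop_in_WH[OF wC] this onto]
  obtain h where "h \<in> rl_hom (reslat_of_hoop P) (reslat_of_hoop ?C)"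
    and "\<forall>x\<in>carrier (reslat_of_hoop P). ?f x = ?g (h x)" ..
  then have h: "h \<in> hoop_hom P ?C" "\<And>x. x \<in> carrier P \<Longrightarrow> ?f x = ?g (h x)"
    by (simp_all only: rl_hom_reslat_of_hoop[OF P]) (simp add: reslat_of_hoop_def)
  \<comment> \<open>Undoing the copy with \<open>?d\<close> and including \<open>S\<close> into
    \<open>B\<close> turns a lift between the copies into a lift of \<open>f\<close> along
    \<open>g\<close>.\<close>
  have "(\<lambda>x. ?d (h x)) \<in> hoop_hom P B"
    using hoop_hom_compose[OF hoop_hom_compose[OF h(1) d] inc] .
  moreover have "g (?d (h x)) = f x" if x: "x \<in> carrier P" for x
  proof (rule inj_onD[OF a])
    show "a (g (?d (h x))) = a (f x)" using h(2)[OF x] by simp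
    show "f x \<in> carrier A" using f x by (auto simp: hoop_hom_def)
    show "g (?d (h x)) \<in> carrier A"
      using hoop_hom_compose[OF hoop_hom_compose[OF h(1) d] gC] x by (auto simp: hoop_hom_def)
  qed
  ultimately show False using no_lift by blast
qed

section \<open>Products, and intervals in lattice-ordered groups\<close>

definition Pi_hoop :: "('i \<Rightarrow> 'a hoop) \<Rightarrow> ('i \<Rightarrow> 'a) hoop" where
  "Pi_hoop A =
    \<lparr>carrier = {x. \<forall>i. x i \<in> carrier (A i)},
     mult = (\<lambda>x y i. x i \<otimes>\<^bsub>A i\<^esub> y i),
     one = (\<lambda>i. \<one>\<^bsub>A i\<^esub>),
     imp = (\<lambda>x y i. imp (A i) (x i) (y i))\<rparr>"

lemma wajsberg_hoop_Pi_hoop: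
  assumes "\<And>i. wajsberg_hoop (A i)"
  shows "wajsberg_hoop (Pi_hoop A)"
proof -
  interpret wajsberg_hoop "A i" for i by fact
  show ?thesis
    unfolding Pi_hoop_def
    by unfold_locales
      (auto simp: m_assoc imp_closed imp_self currying intro!: ext intro: m_comm divisibility tanaka)
qed

definition prod_hoop :: "'a hoop \<Rightarrow> 'b hoop \<Rightarrow> ('a \<times> 'b) hoop" where
  "prod_hoop A B =
    \<lparr>carrier = carrier A \<times> carrier B,
     mult = (\<lambda>p q. (fst p \<otimes>\<^bsub>A\<^esub> fst q, snd p \<otimes>\<^bsub>B\<^esub> snd q)),
     one = (\<one>\<^bsub>A\<^esub>, \<one>\<^bsub>B\<^esub>),
     imp = (\<lambda>p q. (imp A (fst p) (fst q), imp B (snd p) (snd q)))\<rparr>"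

lemma wajsberg_hoop_prod_hoop:
  assumes "wajsberg_hoop A" "wajsberg_hoop B"
  shows "wajsberg_hoop (prod_hoop A B)"
proof -
  interpret A: wajsberg_hoop A by fact
  interpret B: wajsberg_hoop B by fact
  show ?thesis
    unfolding prod_hoop_def
    by unfold_locales
      (auto simp: A.m_assoc A.imp_closed A.imp_self A.currying B.m_assoc B.imp_closed B.imp_self
        B.currying intro: A.m_comm B.m_comm A.divisibility B.divisibility A.tanaka B.tanaka)
qed

lemma Gamma_hoop_simps:
  fixes u :: "'g::lattice_ab_group_add"
  shows "carrier (Gamma_hoop u) = {0..u}" "\<one>\<^bsub>Gamma_hoop u\<^esub> = u"
    "x \<otimes>\<^bsub>Gamma_hoop u\<^esub> y = sup (x + y - u) 0"
    "imp (Gamma_hoop u) x y = inf (u - x + y) u"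
  by (simp_all add: Gamma_hoop_def mv_neg_def mv_oplus_def diff_inf_eq_sup add_sup_distrib_left
      algebra_simps)


section \<open>The algebras \<open>C_omega\<close> and \<open>C_lex\<close>\<close>

text \<open>Each factor \<open>x\<close> subtracts the defect \<open>u - x\<close> once more, until
  truncation at 0.\<close>

lemma Gamma_hoop_int_nat_pow:
  fixes u x :: int
  assumes "x \<in> {0..u}"
  shows "x [^]\<^bsub>Gamma_hoop u\<^esub> (m::nat) = max 0 (u - int m * (u - x))"
proof (induction m)
  case 0
  then show ?case using assms by (simp add: Gamma_hoop_simps nat_pow_def)
next
  case (Suc m)
  have "x [^]\<^bsub>Gamma_hoop u\<^esub> Suc m = x [^]\<^bsub>Gamma_hoop u\<^esub> m \<otimes>\<^bsub>Gamma_hoop u\<^esub> x"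
    by (simp add: nat_pow_def)
  then show ?case
    using assms by (simp add: Suc Gamma_hoop_simps sup_max algebra_simps max_def)
qed

text \<open>In the target every element other than the unit is nilpotent; for a nilpotency exponent
  \<open>m\<close> of \<open>h a\<close> the hypothesis on \<open>a\<close> turns into \<open>0 \<leadsto> 0 = h a\<close>.\<close>

lemma hom_to_Gamma_hoop_int_eq_one:
  fixes u :: int
  assumes P: "wajsberg_hoop P" and h: "h \<in> hoop_hom P (Gamma_hoop u)" and a: "a \<in> carrier P"
    and cancel: "\<And>m::nat. imp P (a [^]\<^bsub>P\<^esub> m) (a [^]\<^bsub>P\<^esub> Suc m) = a"
  shows "h a = u"
proof (rule ccontr)
  interpret wajsberg_hoop P by fact
  assume "h a \<noteq> u"
  have ha: "h a \<in> {0..u}" using h a by (auto simp: hoop_hom_def Gamma_hoop_simps)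
  with \<open>h a \<noteq> u\<close> have c: "u - h a \<ge> 1" and u: "u \<ge> 1" by auto
  \<comment> \<open>The integer defect \<open>u - h a\<close> is at least 1, so \<open>u\<close> or
    more factors reach 0.\<close>
  have z: "h a [^]\<^bsub>Gamma_hoop u\<^esub> m = 0" if "int m \<ge> u" for m :: nat
  proof -
    have "u * 1 \<le> int m * (u - h a)" using that c u by (intro mult_mono) auto
    then show ?thesis by (simp add: Gamma_hoop_int_nat_pow[OF ha])
  qed
  obtain m :: nat where m: "int m = u" using u by (metis nonneg_int_cases order_trans zero_le_one)
  have "h a = h (imp P (a [^]\<^bsub>P\<^esub> m) (a [^]\<^bsub>P\<^esub> Suc m))"
    by (simp only: cancel)
  also have "\<dots> = imp (Gamma_hoop u) (h (a [^]\<^bsub>P\<^esub> m)) (h (a [^]\<^bsub>P\<^esub> Suc m))"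
    using h nat_pow_closed[OF a, of m] nat_pow_closed[OF a, of "Suc m"]
    by (simp add: hoop_hom_def del: nat_pow_Suc)
  also have "\<dots> = imp (Gamma_hoop u) 0 0"
    by (simp only: hoop_hom_nat_pow[OF P h a]) (simp only: z m of_nat_Suc zle_add1_eq_le order_refl)
  also have "\<dots> = u"
    using u by (simp add: Gamma_hoop_simps)
  finally show False using \<open>h a \<noteq> u\<close> by simp
qed

section \<open>Integer lines and the lexicographic order\<close>

definition lin_eval :: "int \<times> int \<Rightarrow> nat \<Rightarrow> int" where
  "lin_eval p k = fst p * int k + snd p"

lemma lin_eval_add: "lin_eval (p + q) k = lin_eval p k + lin_eval q k"
  and lin_eval_diff: "lin_eval (p - q) k = lin_eval p k - lin_eval q k"
  and lin_eval_zero: "lin_eval 0 k = 0"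
  by (simp_all add: lin_eval_def algebra_simps)

text \<open>The larger slope \<open>fst\<close> wins for large \<open>k\<close>, and equal slopes
  leave the comparison to the constants: lexicographic order is eventual domination.\<close>

lemma eventually_lin_eval_mono:
  assumes "p \<le> q"
  shows "\<forall>\<^sub>F k in sequentially. lin_eval p k \<le> lin_eval q k"
proof (cases "fst p < fst q")
  case True
  have "lin_eval p k \<le> lin_eval q k" if "k \<ge> nat (snd p - snd q)" for k
  proof -
    have "1 * int k \<le> (fst q - fst p) * int k" using True by (intro mult_right_mono) auto
    then show ?thesis using that by (simp add: lin_eval_def algebra_simps)
  qed
  then show ?thesis unfolding eventually_sequentially by blast
next
  case False
  then show ?thesis using assms by (auto simp: less_eq_prod_def lin_eval_def)
qed

text \<open>The lexicographic order is total, so \<open>inf p q\<close> and \<open>sup p q\<close>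
  are among \<open>p\<close> and \<open>q\<close>, and eventual monotonicity decides.\<close>

lemma
  shows eventually_lin_eval_inf:
      "\<forall>\<^sub>F k in sequentially. lin_eval (inf p q) k = inf (lin_eval p k) (lin_eval q k)"
    and eventually_lin_eval_sup:
      "\<forall>\<^sub>F k in sequentially. lin_eval (sup p q) k = sup (lin_eval p k) (lin_eval q k)"
proof -
  have "(\<forall>\<^sub>F k in sequentially. lin_eval (inf p q) k = inf (lin_eval p k) (lin_eval q k)) \<and>
    (\<forall>\<^sub>F k in sequentially. lin_eval (sup p q) k = sup (lin_eval p k) (lin_eval q k))"
  proof (cases "p \<le> q")
    case True
    from eventually_lin_eval_mono[OF this] show ?thesis
      by (auto simp: inf_absorb1[OF True] sup_absorb2[OF True] inf.absorb1 sup.absorb2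
          elim: eventually_mono)
  next
    case False
    then have le: "q \<le> p" by simp
    from eventually_lin_eval_mono[OF this] show ?thesis
      by (auto simp: inf_absorb2[OF le] sup_absorb1[OF le] inf.absorb2 sup.absorb1
          elim: eventually_mono)
  qed
  then show "\<forall>\<^sub>F k in sequentially. lin_eval (inf p q) k = inf (lin_eval p k) (lin_eval q k)"
    "\<forall>\<^sub>F k in sequentially. lin_eval (sup p q) k = sup (lin_eval p k) (lin_eval q k)"
    by blast+
qed

text \<open>The algebra \<open>C_lex n\<close> is the algebra of germs at infinity of the sequences
  \<open>k \<mapsto> i k + j\<close> in the product of the finite chains \<open>Gamma_hoop (n k)\<close>.\<close>

definition germ_carrier :: "nat \<Rightarrow> ((int \<times> int) \<times> (nat \<Rightarrow> int)) set" where
  "germ_carrier n = {(p, x). p \<in> carrier (C_lex n) \<and> (\<forall>k. x k \<in> {0..int n * int k}) \<and>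
    (\<forall>\<^sub>F k in sequentially. x k = lin_eval p k)}"

definition germ_hoop :: "nat \<Rightarrow> ((int \<times> int) \<times> (nat \<Rightarrow> int)) hoop" where
  "germ_hoop n = (prod_hoop (C_lex n) (Pi_hoop (\<lambda>k. Gamma_hoop (int n * int k))))
    \<lparr>carrier := germ_carrier n\<rparr>"

lemma lin_eval_unit: "lin_eval (int n, 0) k = int n * int k"
  by (simp add: lin_eval_def)

text \<open>The operations are built from sums, differences, \<open>inf\<close> and
  \<open>sup\<close>. \<open>lin_eval\<close> commutes with the first two for all \<open>k\<close>
  and with the last two for all large \<open>k\<close>, which gives closure.\<close>

lemma wajsberg_hoop_germ_hoop: "wajsberg_hoop (germ_hoop n)"
  unfolding germ_hoop_def
proof (rule wajsberg_hoop_subset)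
  let ?G = "\<lambda>k. Gamma_hoop (int n * int k)"
  let ?A = "prod_hoop (C_lex n) (Pi_hoop ?G)"
  interpret C: wajsberg_hoop "C_lex n" by (rule wajsberg_hoop_C_lex)
  have G: "wajsberg_hoop (?G k)" for k by (intro wajsberg_hoop_Gamma_hoop) simp
  interpret G: wajsberg_hoop "?G k" for k by (rule G)
  show "wajsberg_hoop ?A"
    by (intro wajsberg_hoop_prod_hoop wajsberg_hoop_C_lex wajsberg_hoop_Pi_hoop G)
  show "germ_carrier n \<subseteq> carrier ?A"
    by (auto simp: germ_carrier_def prod_hoop_def Pi_hoop_def Gamma_hoop_simps)
  show "\<one>\<^bsub>?A\<^esub> \<in> germ_carrier n"
    using C.one_closed
    by (auto simp: germ_carrier_def prod_hoop_def Pi_hoop_def Gamma_hoop_simps C_lex_def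
        lin_eval_unit)
  fix r s assume "r \<in> germ_carrier n" "s \<in> germ_carrier n"
  then obtain p x q y where rs: "r = (p, x)" "s = (q, y)"
    and pq: "p \<in> carrier (C_lex n)" "q \<in> carrier (C_lex n)"
    and xy: "\<And>k. x k \<in> carrier (?G k)" "\<And>k. y k \<in> carrier (?G k)"
    and x: "\<forall>\<^sub>F k in sequentially. x k = lin_eval p k"
    and y: "\<forall>\<^sub>F k in sequentially. y k = lin_eval q k"
    by (auto simp: germ_carrier_def Gamma_hoop_simps)
  have "\<forall>\<^sub>F k in sequentially. x k \<otimes>\<^bsub>?G k\<^esub> y k = lin_eval (p \<otimes>\<^bsub>C_lex n\<^esub> q) k"
    using x y eventually_lin_eval_sup[of "p + q - (int n, 0)" 0]
    by eventually_elim
      (simp add: Gamma_hoop_simps C_lex_def lin_eval_add lin_eval_diff lin_eval_zero lin_eval_unit)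
  then show "r \<otimes>\<^bsub>?A\<^esub> s \<in> germ_carrier n"
    using C.m_closed[OF pq] G.m_closed[OF xy]
    by (simp add: rs germ_carrier_def prod_hoop_def Pi_hoop_def Gamma_hoop_simps(1))
  have "\<forall>\<^sub>F k in sequentially. imp (?G k) (x k) (y k) = lin_eval (imp (C_lex n) p q) k"
    using x y eventually_lin_eval_inf[of "(int n, 0) - p + q" "(int n, 0)"]
    by eventually_elim
      (simp add: Gamma_hoop_simps C_lex_def lin_eval_add lin_eval_diff lin_eval_zero lin_eval_unit)
  then show "imp ?A r s \<in> germ_carrier n"
    using C.imp_closed[OF pq] G.imp_closed[OF xy]
    by (simp add: rs germ_carrier_def prod_hoop_def Pi_hoop_def Gamma_hoop_simps(1))
qed

text \<open>Keeping \<open>p\<close> beside the sequence in \<open>germ_carrier\<close> makes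
  passing to the germ a plain projection.\<close>

lemma fst_germ_hoop_hom: "fst \<in> hoop_hom (germ_hoop n) (C_lex n)"
  by (auto simp: hoop_hom_def germ_hoop_def germ_carrier_def prod_hoop_def)

lemma snd_germ_hoop_hom:
  "(\<lambda>r. snd r k) \<in> hoop_hom (germ_hoop n) (Gamma_hoop (int n * int k))"
  by (auto simp: hoop_hom_def germ_hoop_def germ_carrier_def prod_hoop_def Pi_hoop_def
      Gamma_hoop_simps(1))

lemma fst_germ_hoop_onto: "carrier (C_lex n) \<subseteq> fst ` carrier (germ_hoop n)"
proof
  fix p assume p: "p \<in> carrier (C_lex n)"
  \<comment> \<open>Clamping puts every entry into its chain; it changes nothing for large
    \<open>k\<close>, as \<open>0 \<le> p \<le> (int n, 0)\<close>.\<close>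
  define x where "x k = max 0 (min (int n * int k) (lin_eval p k))" for k
  have "0 \<le> p" "p \<le> (int n, 0)" using p by (auto simp: C_lex_def Gamma_hoop_simps)
  from this[THEN eventually_lin_eval_mono]
  have "\<forall>\<^sub>F k in sequentially. x k = lin_eval p k"
    by eventually_elim (simp add: x_def lin_eval_zero lin_eval_unit)
  then have "(p, x) \<in> carrier (germ_hoop n)"
    using p by (simp add: germ_hoop_def germ_carrier_def x_def)
  then show "p \<in> fst ` carrier (germ_hoop n)" by force
qed

text \<open>A lift sends \<open>a\<close> to a pair whose sequence is the unit in every finite
  chain. Its germ is then the unit of \<open>C_lex n\<close>, contrary to the choice of
  \<open>a\<close>.\<close>

lemma not_projective_of_hom_to_C_lex:
  assumes u: "infinite (UNIV :: 'u set)"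
    and P: "wajsberg_hoop P" and f: "f \<in> hoop_hom P (C_lex n)"
    and a: "a \<in> carrier P" "f a \<noteq> \<one>\<^bsub>C_lex n\<^esub>"
    and cancel: "\<And>m::nat. imp P (a [^]\<^bsub>P\<^esub> m) (a [^]\<^bsub>P\<^esub> Suc m) = a"
  shows "\<not> projective_in (WH :: 'u reslat set) (reslat_of_hoop P)"
proof (rule not_projective_in_WH[OF u P wajsberg_hoop_C_lex _ wajsberg_hoop_germ_hoop f
      fst_germ_hoop_hom fst_germ_hoop_onto])
  fix h assume h: "h \<in> hoop_hom P (germ_hoop n)" and lift: "\<And>x. x \<in> carrier P \<Longrightarrow> fst (h x) = f x"
  obtain i j x where r: "h a = ((i, j), x)" by (metis prod.collapse)
  have "x k = int n * int k" for k
    using hom_to_Gamma_hoop_int_eq_one[OF P hoop_hom_compose[OF h snd_germ_hoop_hom] a(1) cancel, of k]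
    by (simp add: r)
  moreover have "\<forall>\<^sub>F k in sequentially. x k = lin_eval (i, j) k"
    using h a(1) r by (auto simp: hoop_hom_def germ_hoop_def germ_carrier_def Pi_iff)
  ultimately obtain N where N: "\<And>k. k \<ge> N \<Longrightarrow> int n * int k = i * int k + j"
    unfolding eventually_sequentially lin_eval_def by auto
  \<comment> \<open>Two consecutive indices determine the slope and the constant of a line.\<close>
  from N[of N] N[of "Suc N"] have "i = int n" "j = 0" by (auto simp: algebra_simps)
  then show False using lift[OF a(1)] a(2) r by (simp add: C_lex_def Gamma_hoop_simps)
qed auto

lemma not_projective_C_lex:
  assumes "infinite (UNIV :: 'u set)" "n \<ge> 1"
  shows "\<not> projective_in (WH :: 'u reslat set) (reslat_of_hoop (C_lex n))"
proof (rule not_projective_of_hom_to_C_lex[OF assms(1) wajsberg_hoop_C_lex, where a = "(int n, - 1)"])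
  show "(\<lambda>x. x) \<in> hoop_hom (C_lex n) (C_lex n)" by (simp add: hoop_hom_def)
  \<comment> \<open>The witness is the coatom of \<open>C_lex n\<close>. Since
    \<open>n \<ge> 1\<close>, every \<open>(int n, - int m)\<close> is still lexicographically
    positive, so no power is truncated.\<close>
  have pow: "(int n, - 1) [^]\<^bsub>C_lex n\<^esub> (m::nat) = (int n, - int m)" for m
    using assms(2)
    by (induction m)
      (auto simp: C_lex_def Gamma_hoop_simps nat_pow_def zero_prod_def sup_prod_def less_eq_prod_def)
  show "imp (C_lex n) ((int n, - 1) [^]\<^bsub>C_lex n\<^esub> m) ((int n, - 1) [^]\<^bsub>C_lex n\<^esub> Suc m) = (int n, - 1)"
    for m :: nat
    unfolding pow by (simp add: C_lex_def Gamma_hoop_simps inf_prod_def)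
qed (use assms(2) in \<open>auto simp: C_lex_def Gamma_hoop_simps less_eq_prod_def\<close>)

lemma not_projective_C_omega:
  assumes "infinite (UNIV :: 'u set)"
  shows "\<not> projective_in (WH :: 'u reslat set) (reslat_of_hoop C_omega)"
proof (rule not_projective_of_hom_to_C_lex[OF assms wajsberg_hoop_C_omega, where a = 1])
  \<comment> \<open>\<open>C_omega\<close> is embedded into \<open>C_lex 1\<close> as the elements
    infinitely close to the unit \<open>(1, 0)\<close>.\<close>
  have "0 \<le> (1 :: int, c :: int)" for c by (simp add: less_eq_prod_def)
  moreover have "inf (1 :: int, int x - int y) (1, 0) = (1, - int (y - x))" for x y
    by (cases "x \<le> y") (simp_all add: inf_prod_def less_eq_prod_def of_nat_diff)
  moreover have "(1, c) \<le> (1 :: int, 0 :: int) \<longleftrightarrow> c \<le> 0" for c by (simp add: less_eq_prod_def)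
  ultimately show "(\<lambda>k. (1, - int k)) \<in> hoop_hom C_omega (C_lex 1)"
    by (simp add: hoop_hom_def C_omega_def C_lex_def Gamma_hoop_simps sup.absorb1)
  \<comment> \<open>Elements are exponents: \<open>1\<close> is the generator, while the unit is
    \<open>0\<close>.\<close>
  have pow: "1 [^]\<^bsub>C_omega\<^esub> (m::nat) = m" for m
    by (induction m) (auto simp: C_omega_def nat_pow_def)
  show "imp C_omega (1 [^]\<^bsub>C_omega\<^esub> m) (1 [^]\<^bsub>C_omega\<^esub> Suc m) = 1" for m :: nat
    unfolding pow by (simp add: C_omega_def)
qed (auto simp: C_omega_def C_lex_def Gamma_hoop_simps)


section \<open>The algebras \<open>W\<close>\<close>

text \<open>Paths from a point of \<open>W n\<close> to the unit. The domain is all of \<real>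
  because the index set of \<open>Pi_hoop\<close> is a whole type.\<close>

definition path_carrier :: "nat \<Rightarrow> (real \<Rightarrow> real) set" where
  "path_carrier n = {\<phi>. continuous_on UNIV \<phi> \<and> (\<forall>t. \<phi> t \<in> {0..1}) \<and>
    \<phi> 0 \<in> carrier (W n) \<and> \<phi> 1 = 1}"

definition path_hoop :: "nat \<Rightarrow> (real \<Rightarrow> real) hoop" where
  "path_hoop n = (Pi_hoop (\<lambda>_. Gamma_hoop 1))\<lparr>carrier := path_carrier n\<rparr>"

text \<open>Makes \<open>W n\<close> a subalgebra of the real unit interval, so that evaluating
  paths at 0 is a homomorphism.\<close>

lemma W_simps:
  "\<one>\<^bsub>W n\<^esub> = 1" "x \<otimes>\<^bsub>W n\<^esub> y = x \<otimes>\<^bsub>Gamma_hoop 1\<^esub> y" "imp (W n) x y = imp (Gamma_hoop 1) x y"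
  by (simp_all add: W_def Gamma_hoop_simps sup_max inf_min max.commute min.commute)

lemma wajsberg_hoop_path_hoop:
  assumes "n \<ge> 2"
  shows "wajsberg_hoop (path_hoop n)"
  unfolding path_hoop_def
proof (rule wajsberg_hoop_subset)
  let ?A = "Pi_hoop (\<lambda>_::real. Gamma_hoop (1::real))"
  interpret W: wajsberg_hoop "W n" by (rule wajsberg_hoop_W[OF assms])
  have G: "wajsberg_hoop (Gamma_hoop (1::real))" by (rule wajsberg_hoop_Gamma_hoop) simp
  then interpret G: wajsberg_hoop "Gamma_hoop (1::real)" .
  show "wajsberg_hoop ?A" by (intro wajsberg_hoop_Pi_hoop G)
  show "path_carrier n \<subseteq> carrier ?A"
    by (auto simp: path_carrier_def Pi_hoop_def Gamma_hoop_simps)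
  show "\<one>\<^bsub>?A\<^esub> \<in> path_carrier n"
    using W.one_closed by (auto simp: path_carrier_def Pi_hoop_def Gamma_hoop_simps W_simps)
  fix \<phi> \<psi> assume p: "\<phi> \<in> path_carrier n" "\<psi> \<in> path_carrier n"
  then have "\<phi> 0 \<in> carrier (W n)" "\<psi> 0 \<in> carrier (W n)"
    and r: "\<And>t. \<phi> t \<in> carrier (Gamma_hoop 1)" "\<And>t. \<psi> t \<in> carrier (Gamma_hoop 1)"
    and c: "continuous_on UNIV \<phi>" "continuous_on UNIV \<psi>" "\<phi> 1 = 1" "\<psi> 1 = 1"
    by (auto simp: path_carrier_def Gamma_hoop_simps)
  \<comment> \<open>At 0 closure comes from \<open>W n\<close>, at the other points from the unit
    interval.\<close>
  note w = W.m_closed[OF this(1,2), unfolded W_simps] W.imp_closed[OF this(1,2), unfolded W_simps]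
  have "continuous_on UNIV (\<lambda>t. \<phi> t \<otimes>\<^bsub>Gamma_hoop 1\<^esub> \<psi> t)"
    unfolding Gamma_hoop_simps sup_max by (intro continuous_intros c)
  then show "\<phi> \<otimes>\<^bsub>?A\<^esub> \<psi> \<in> path_carrier n"
    using w G.m_closed[OF r] c(3,4)
    by (simp add: path_carrier_def Pi_hoop_def) (simp add: Gamma_hoop_simps sup_max)
  have "continuous_on UNIV (\<lambda>t. imp (Gamma_hoop 1) (\<phi> t) (\<psi> t))"
    unfolding Gamma_hoop_simps inf_min by (intro continuous_intros c)
  then show "imp ?A \<phi> \<psi> \<in> path_carrier n"
    using w G.imp_closed[OF r] c(3,4)
    by (simp add: path_carrier_def Pi_hoop_def) (simp add: Gamma_hoop_simps sup_max)
qed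

lemma not_projective_W:
  assumes u: "infinite (UNIV :: 'u set)" and n: "n \<ge> 2"
  shows "\<not> projective_in (WH :: 'u reslat set) (reslat_of_hoop (W n))"
proof (rule not_projective_in_WH[OF u wajsberg_hoop_W[OF n] wajsberg_hoop_W[OF n] _
      wajsberg_hoop_path_hoop[OF n]])
  show "countable (carrier (W n))" by (simp add: W_def)
  show "(\<lambda>x. x) \<in> hoop_hom (W n) (W n)" by (simp add: hoop_hom_def)
  show "(\<lambda>\<phi>. \<phi> 0) \<in> hoop_hom (path_hoop n) (W n)"
    by (auto simp: hoop_hom_def path_hoop_def path_carrier_def Pi_hoop_def W_simps Gamma_hoop_simps(2))
  show "carrier (W n) \<subseteq> (\<lambda>\<phi>. \<phi> 0) ` carrier (path_hoop n)"
  proof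
    fix y assume y: "y \<in> carrier (W n)"
    then have y01: "0 \<le> y" "y \<le> 1" using n by (auto simp: W_def)
    \<comment> \<open>This path is \<open>y\<close> at 0 because \<open>0 \<le> y\<close>, and 1 at
      1 because \<open>y \<le> 1\<close>.\<close>
    have "(\<lambda>t. max y (min 1 t)) \<in> carrier (path_hoop n)"
      using y y01 by (auto simp: path_hoop_def path_carrier_def intro!: continuous_on_max continuous_on_min
            continuous_on_const continuous_on_id)
    then show "y \<in> (\<lambda>\<phi>. \<phi> 0) ` carrier (path_hoop n)"
      using y01 by (intro image_eqI[of _ _ "\<lambda>t. max y (min 1 t)"]) auto
  qed
  fix h assume h: "h \<in> hoop_hom (W n) (path_hoop n)" and lift: "\<And>x. x \<in> carrier (W n) \<Longrightarrow> h x 0 = x"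
  have z: "0 \<in> carrier (W n)" by (force simp: W_def)
  have zz: "0 \<otimes>\<^bsub>W n\<^esub> 0 = 0" by (simp add: W_def)
  have p: "continuous_on UNIV (h 0)" "h 0 1 = 1"
    using h z by (auto simp: hoop_hom_def path_hoop_def path_carrier_def Pi_iff)
  have "h 0 \<otimes>\<^bsub>path_hoop n\<^esub> h 0 = h 0"
    using h z zz unfolding hoop_hom_def by (metis (mono_tags, lifting) mem_Collect_eq)
  then have idem: "h 0 t \<otimes>\<^bsub>Gamma_hoop 1\<^esub> h 0 t = h 0 t" for t
    by (simp add: path_hoop_def Pi_hoop_def) (metis (mono_tags))
  \<comment> \<open>\<open>h 0\<close> runs from 0 at 0 to 1 at 1, so it passes through 1/2, whose
    square in \<open>Gamma_hoop 1\<close> is 0.\<close>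
  obtain t where "h 0 t = 1 / 2"
    using IVT'[of "h 0" 0 "1/2" 1] lift[OF z] p continuous_on_subset by fastforce
  with idem[of t] show False by (simp add: Gamma_hoop_simps sup_max)
qed

theorem corollary5p5:
  assumes "infinite (UNIV :: 'u set)"
  shows
    "(\<not> projective_in (WH :: 'u reslat set) (reslat_of_hoop C_omega) \<and>
      (\<forall>n\<ge>1. \<not> projective_in (WH :: 'u reslat set) (reslat_of_hoop (C_lex n))) \<and>
      (\<forall>n\<ge>2. \<not> projective_in (WH :: 'u reslat set) (reslat_of_hoop (W n)))) \<and>
     (\<forall>V :: 'u reslat set. rl_variety V \<and> WH \<subseteq> V \<longrightarrow>
      \<not> projective_in V (reslat_of_hoop C_omega) \<and>
      (\<forall>n\<ge>1. \<not> projective_in V (reslat_of_hoop (C_lex n))) \<and>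
      (\<forall>n\<ge>2. \<not> projective_in V (reslat_of_hoop (W n))))"
proof -
  have *: "\<not> projective_in V (reslat_of_hoop C_omega) \<and>
      (\<forall>n\<ge>1. \<not> projective_in V (reslat_of_hoop (C_lex n))) \<and>
      (\<forall>n\<ge>2. \<not> projective_in V (reslat_of_hoop (W n)))"
    if V: "WH \<subseteq> V" for V :: "'u reslat set"
    by (intro conjI allI impI not_projective_in_superset[OF _ V] not_projective_C_omega[OF assms]
        not_projective_C_lex[OF assms] not_projective_W[OF assms])
  show ?thesis
    by (rule conjI[OF *[OF order_refl]], intro allI impI, rule *, erule conjunct2)
qed

end
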